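(* Fix an integer $d\ge 1$. There is a constant $C_0=C_0(d)>0$ such that the following holds for all sufficiently large $n$. Let $L>0$ (possibly depending on $n$), let $g:\mathcal{LT}_n\to\mathbb R$ be an $L$-Lipschitz function, and set $\mu=\mathbb E[g(G_n)]$, where $G_n$ is the $d$-NN tree on $n$ vertices. Then, for every $\phi=\phi(n)\in[C_0\log n,\,n/3]$ and every $t\ge 0$, $$\mathbb P\big[|g(G_n)-\mu|\ge t\big]\le 2\exp\left(-\frac{t^2}{20nL^2\phi^2}\right)+\exp\left(-\frac{\phi\log\phi}{10}\right).$$
   Context: Here $\log$ is the natural logarithm. Let $\mathbb T^d_n$ be the $d$-dimensional torus of volume $n$ (that is, $\mathbb R^d/(n^{1/d}\mathbb Z)^d$) with the metric inherited from the Euclidean metric. The $d$-NN tree $G_n$: vertices $0,1,\dots,n-1$ arrive one by one, vertex $i$ being placed at a uniformly random point of $\mathbb T^d_n$, independently of all others; each vertex $i\ge 1$ is connected upon arrival by an edge to the closest vertex among $\{0,\dots,i-1\}$ in the torus metric (ties have probability $0$). $G_n$ is a tree on $\{0,\dots,n-1\}$, rooted at $0$. $\mathcal{LT}_n$ is the set of labeled trees with vertex set $\{0,1,\dots,n-1\}$ rooted at $0$. A function $g:\mathcal{LT}_n\to\mathbb R$ is $L$-Lipschitz if $|g(T_1)-g(T_2)|\le L\,|E(T_1)\,\Delta\,E(T_2)|$ for all $T_1,T_2\in\mathcal{LT}_n$, where $\Delta$ is symmetric difference and $E(T)$ is the edge set of $T$. *)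

theory Defs
  imports "HOL-Probability.Probability"
begin

text \<open>
  A labeled tree on \<open>{0,\<dots>,n-1}\<close> is represented by its edge set, an edge being a two-element set
  of vertices. The root is always \<open>0\<close> and therefore carries no data.
\<close>

definition graph_connected :: "nat \<Rightarrow> nat set set \<Rightarrow> bool" where
  "graph_connected n E \<longleftrightarrow> (\<forall>u<n. \<forall>v<n. (u, v) \<in> {(a, b). {a, b} \<in> E}\<^sup>*)"

definition has_cycle :: "nat set set \<Rightarrow> bool" where
  "has_cycle E \<longleftrightarrow> (\<exists>vs. 3 \<le> length vs \<and> distinct vs \<and>
     (\<forall>i<length vs. {vs ! i, vs ! (Suc i mod length vs)} \<in> E))"

definition labeled_trees :: "nat \<Rightarrow> nat set set set" where
  "labeled_trees n = {E. E \<subseteq> {{u, v} | u v. u < n \<and> v < n \<and> u \<noteq> v} \<and>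
     graph_connected n E \<and> \<not> has_cycle E}"

definition tree_lipschitz :: "nat \<Rightarrow> real \<Rightarrow> (nat set set \<Rightarrow> real) \<Rightarrow> bool" where
  "tree_lipschitz n L g \<longleftrightarrow> (\<forall>T1\<in>labeled_trees n. \<forall>T2\<in>labeled_trees n.
     \<bar>g T1 - g T2\<bar> \<le> L * real (card (sym_diff T1 T2)))"

text \<open>
  The torus \<open>\<real>\<^sup>d / (n\<^sup>1\<^sup>/\<^sup>d \<int>)\<^sup>d\<close> with \<open>d = CARD('d)\<close>: points are given by representatives in \<open>\<real>\<^sup>d\<close>, the
  distance is the quotient distance, and a uniform point of the torus is a uniform point of the
  fundamental domain \<open>[0, n\<^sup>1\<^sup>/\<^sup>d)\<^sup>d\<close>.
\<close>

definition torus_side :: "'d::finite itself \<Rightarrow> nat \<Rightarrow> real" where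
  "torus_side _ n = root CARD('d) (real n)"

definition torus_lattice :: "nat \<Rightarrow> (real^'d::finite) set" where
  "torus_lattice n = range (\<lambda>k :: int^'d. \<chi> i. torus_side TYPE('d) n * of_int (k $ i))"

definition torus_domain :: "nat \<Rightarrow> (real^'d::finite) set" where
  "torus_domain n = {x. \<forall>i. 0 \<le> x $ i \<and> x $ i < torus_side TYPE('d) n}"

definition torus_dist :: "nat \<Rightarrow> real^'d::finite \<Rightarrow> real^'d \<Rightarrow> real" where
  "torus_dist n x y = (INF z\<in>torus_lattice n. dist x (y + z))"

definition torus_points :: "nat \<Rightarrow> (nat \<Rightarrow> real^'d::finite) measure" where
  "torus_points n = (\<Pi>\<^sub>M i\<in>{..<n}. uniform_measure lborel (torus_domain n))"

text \<open>Ties, which have probability \<open>0\<close>, are resolved in favour of the vertex that arrived first.\<close>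

definition nn_parent :: "nat \<Rightarrow> (nat \<Rightarrow> real^'d::finite) \<Rightarrow> nat \<Rightarrow> nat" where
  "nn_parent n X i = (LEAST j. j < i \<and> (\<forall>k<i. torus_dist n (X i) (X j) \<le> torus_dist n (X i) (X k)))"

definition nn_tree :: "nat \<Rightarrow> (nat \<Rightarrow> real^'d::finite) \<Rightarrow> nat set set" where
  "nn_tree n X = (\<lambda>i. {nn_parent n X i, i}) ` {1..<n}"


lemma nn_parent_less:
  assumes "0 < i"
  shows "nn_parent n X i < i"
proof -
  let ?f = "\<lambda>j. torus_dist n (X i) (X j)"
  have "finite (?f ` {..<i})" "?f ` {..<i} \<noteq> {}" using assms by auto
  then have "Min (?f ` {..<i}) \<in> ?f ` {..<i}" by (rule Min_in)
  then obtain j where j: "j < i" "?f j = Min (?f ` {..<i})" by auto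
  have "j < i \<and> (\<forall>k<i. ?f j \<le> ?f k)" using j by simp
  then show ?thesis unfolding nn_parent_def by (rule LeastI2) auto
qed

lemma nn_tree_edge:
  assumes "{a, b} \<in> nn_tree n X" "b \<le> a"
  shows "b = nn_parent n X a \<and> b < a"
proof -
  obtain i where i: "1 \<le> i" "{a, b} = {nn_parent n X i, i}"
    using assms(1) unfolding nn_tree_def by auto
  then show ?thesis using nn_parent_less[of i n X] assms(2) by (auto simp: doubleton_eq_iff)
qed

lemma nn_tree_in_labeled_trees: "nn_tree n X \<in> labeled_trees n"
proof -
  let ?E = "nn_tree n X"
  have "?E \<subseteq> {{u, v} | u v. u < n \<and> v < n \<and> u \<noteq> v}"
  proof
    fix e assume "e \<in> ?E"
    then obtain i where i: "1 \<le> i" "i < n" "e = {nn_parent n X i, i}"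
      unfolding nn_tree_def by auto
    then show "e \<in> {{u, v} | u v. u < n \<and> v < n \<and> u \<noteq> v}"
      using nn_parent_less[of i n X] by fastforce
  qed
  moreover have "graph_connected n ?E"
  proof -
    let ?R = "{(a, b). {a, b} \<in> ?E}"
    have symR: "sym ?R" by (auto simp: sym_def insert_commute)
    have 0: "v < n \<Longrightarrow> (v, 0) \<in> ?R\<^sup>*" for v
    proof (induction v rule: less_induct)
      case (less v)
      show ?case
      proof (cases "v = 0")
        case False
        then have p: "nn_parent n X v < v" by (simp add: nn_parent_less)
        have "{v, nn_parent n X v} \<in> ?E"
          unfolding nn_tree_def using False less.prems by (auto simp: insert_commute)
        moreover have "(nn_parent n X v, 0) \<in> ?R\<^sup>*" using less p by auto
        ultimately show ?thesis by (auto intro: converse_rtrancl_into_rtrancl)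
      qed simp
    qed
    have "(u, v) \<in> ?R\<^sup>*" if "u < n" "v < n" for u v
      using 0[OF that(1)] 0[OF that(2)] sym_rtrancl[OF symR]
      by (meson symD rtrancl_trans)
    then show ?thesis unfolding graph_connected_def by blast
  qed
  moreover have "\<not> has_cycle ?E"
  proof
    assume "has_cycle ?E"
    then obtain vs where vs: "3 \<le> length vs" "distinct vs"
      and e: "\<And>i. i < length vs \<Longrightarrow> {vs ! i, vs ! (Suc i mod length vs)} \<in> ?E"
      unfolding has_cycle_def by blast
    let ?m = "length vs"
    have "Max (set vs) \<in> set vs" using vs by (intro Max_in) auto
    then obtain i where i: "i < ?m" "vs ! i = Max (set vs)" by (auto simp: in_set_conv_nth)
    let ?s = "Suc i mod ?m" and ?p = "if i = 0 then ?m - 1 else i - 1"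
    have s: "?s < ?m" and p: "?p < ?m" and ps: "Suc ?p mod ?m = i" and ne: "?p \<noteq> ?s"
      using vs i by (auto simp: mod_Suc)
    have mx: "vs ! k \<le> vs ! i" if "k < ?m" for k using i that by simp
    have "vs ! ?s = nn_parent n X (vs ! i)"
      using nn_tree_edge[OF e[OF i(1)] mx[OF s]] by blast
    moreover have "{vs ! i, vs ! ?p} \<in> ?E"
      using e[OF p] unfolding ps by (simp only: insert_commute)
    then have "vs ! ?p = nn_parent n X (vs ! i)"
      using nn_tree_edge[OF _ mx[OF p]] by blast
    ultimately have "vs ! ?p = vs ! ?s" by simp
    then show False using vs(2) s p ne by (simp only: nth_eq_iff_index_eq)
  qed
  ultimately show ?thesis unfolding labeled_trees_def by blast
qed

lemma finite_labeled_trees: "finite (labeled_trees n)"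
proof (rule finite_subset)
  show "labeled_trees n \<subseteq> Pow (Pow {..<n})" unfolding labeled_trees_def by auto
qed simp

lemma countable_torus_lattice: "countable (torus_lattice n :: (real^'d::finite) set)"
proof -
  have "countable (range (\<lambda>f :: 'd \<Rightarrow> int. \<chi> i. f i))"
    by (intro countable_image countableI_type)
  then have "countable (UNIV :: (int^'d) set)"
    by (rule countable_subset[rotated]) (metis UNIV_I image_iff subsetI vec_nth_inverse)
  then show ?thesis unfolding torus_lattice_def by (rule countable_image)
qed

lemma borel_measurable_torus_dist [measurable]:
  fixes f h :: "'a \<Rightarrow> real^'d::finite"
  assumes [measurable]: "f \<in> borel_measurable M" "h \<in> borel_measurable M"
  shows "(\<lambda>x. torus_dist n (f x) (h x)) \<in> borel_measurable M"
  unfolding torus_dist_def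
  by (intro borel_measurable_cINF_real countable_torus_lattice) measurable

lemma sets_torus_points:
  "sets (torus_points n :: (nat \<Rightarrow> real^'d::finite) measure) = sets (\<Pi>\<^sub>M i\<in>{..<n}. borel)"
  unfolding torus_points_def by (intro sets_PiM_cong) auto

lemma measurable_nn_tree [measurable]:
  "nn_tree n \<in> measurable (torus_points n :: (nat \<Rightarrow> real^'d::finite) measure) (count_space UNIV)"
proof -
  let ?M = "torus_points n :: (nat \<Rightarrow> real^'d) measure"
  have comp: "(\<lambda>X. X i) \<in> borel_measurable ?M" if "i < n" for i
    unfolding measurable_cong_sets[OF sets_torus_points refl]
    using that by (intro measurable_component_singleton) auto
  have par: "(\<lambda>X. nn_parent n X i) \<in> measurable ?M (count_space UNIV)" if i: "i < n" for i
    unfolding nn_parent_def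
  proof (rule measurable_Least)
    fix j
    show "(\<lambda>X. j < i \<and> (\<forall>k<i. torus_dist n (X i) (X j) \<le> torus_dist n (X i) (X k)))
        \<in> measurable ?M (count_space UNIV)"
    proof (cases "j < i")
      case True
      have "Measurable.pred ?M (\<lambda>X. \<forall>k\<in>{..<i}. torus_dist n (X i) (X j) \<le> torus_dist n (X i) (X k))"
      proof (rule measurable_pred_countable)
        fix k assume "k \<in> {..<i}"
        then have "i < n" "j < n" "k < n" using True i by auto
        show "Measurable.pred ?M (\<lambda>X. torus_dist n (X i) (X j) \<le> torus_dist n (X i) (X k))"
          unfolding Measurable.pred_def
          by (rule borel_measurable_le; rule borel_measurable_torus_dist; rule comp; fact)
      qed simp
      then show ?thesis
        by (rule measurable_cong[THEN iffD1, rotated]) (use True in auto)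
    qed simp
  qed
  have "(\<lambda>X. \<lambda>i\<in>{1..<n}. nn_parent n X i) \<in> measurable ?M (\<Pi>\<^sub>M i\<in>{1..<n}. count_space UNIV)"
    by (intro measurable_restrict par) auto
  moreover have "(\<Pi>\<^sub>M i\<in>{1..<n}. count_space (UNIV :: nat set)) = count_space ({1..<n} \<rightarrow>\<^sub>E UNIV)"
    by (rule count_space_PiM_finite) auto
  ultimately have "(\<lambda>X. \<lambda>i\<in>{1..<n}. nn_parent n X i) \<in> measurable ?M (count_space ({1..<n} \<rightarrow>\<^sub>E UNIV))"
    by simp
  then have "(\<lambda>X. (\<lambda>f. (\<lambda>i. {f i, i}) ` {1..<n}) (\<lambda>i\<in>{1..<n}. nn_parent n X i))
      \<in> measurable ?M (count_space UNIV)"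
    by (rule measurable_compose) simp
  then show ?thesis unfolding nn_tree_def
    by simp
qed

lemma prob_space_torus_points:
  assumes "0 < n"
  shows "prob_space (torus_points n :: (nat \<Rightarrow> real^'d::finite) measure)"
proof -
  let ?s = "torus_side TYPE('d) n"
  have s: "0 < ?s" using assms by (simp add: torus_side_def)
  let ?D = "torus_domain n :: (real^'d) set"
  have "box 0 (\<chi> i. ?s) \<subseteq> ?D"
    by (auto simp: torus_domain_def mem_box_cart intro: less_imp_le)
  moreover have "?D \<subseteq> cbox 0 (\<chi> i. ?s)"
    by (auto simp: torus_domain_def mem_box_cart) (metis less_imp_le)
  moreover have "?D \<in> sets lborel"
    unfolding torus_domain_def by simp
  ultimately have "emeasure lborel (box 0 (\<chi> i. ?s) :: (real^'d) set) \<le> emeasure lborel ?D"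
    "emeasure lborel ?D \<le> emeasure lborel (cbox 0 (\<chi> i. ?s) :: (real^'d) set)"
    by (auto intro!: emeasure_mono)
  moreover have "emeasure lborel (box 0 (\<chi> i. ?s) :: (real^'d) set) \<noteq> 0"
  proof -
    have b: "0 < (\<chi> i. ?s) \<bullet> b" if "b \<in> Basis" for b :: "real^'d"
      using that s by (auto simp: Basis_vec_def inner_axis)
    have "0 < (\<Prod>b\<in>(Basis :: (real^'d) set). (\<chi> i. ?s) \<bullet> b)" by (intro prod_pos b)
    moreover have "\<forall>b\<in>Basis. 0 \<bullet> b \<le> (\<chi> i. ?s) \<bullet> (b :: real^'d)"
      using b by (auto intro: less_imp_le)
    ultimately show ?thesis
      unfolding emeasure_lborel_box_eq diff_zero by (subst if_P) (auto simp only: ennreal_eq_0_iff not_le)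
  qed
  moreover have "emeasure lborel (cbox 0 (\<chi> i. ?s) :: (real^'d) set) < \<infinity>"
    by (rule emeasure_lborel_cbox_finite)
  ultimately have "emeasure lborel ?D \<noteq> 0" "emeasure lborel ?D \<noteq> \<infinity>"
    by auto
  then have "prob_space (uniform_measure lborel ?D)"
    by (rule prob_space_uniform_measure)
  then show ?thesis unfolding torus_points_def by (intro prob_space_PiM)
qed

end

theory Submission
  imports Defs "HOL-Analysis.Harmonic_Numbers"
begin

text \<open>
  The Doob martingale of \<open>g (G\<^sub>n)\<close> with respect to the arriving points has increments of
  order \<open>L log n\<close> with certainty, so the Azuma--Hoeffding inequality alone gives the bound, even without
  the second error term. Moving the point \<open>k\<close> only affects the edges towards
  \<open>k\<close> itself and its children. Split the directions at the point \<open>k\<close> into boundedly many narrow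
  cells. Of two later points in one cell, the farther one is closer to the other than to \<open>k\<close>; so a child
  \<open>j > k\<close> is strictly the closest to \<open>k\<close> among the points \<open>k + 1, \<dots>, j\<close> in its cell. By
  exchangeability this has probability at most \<open>1 / (j - k)\<close> given the first \<open>k + 1\<close> points, however
  these are placed. Summation over \<open>j\<close> bounds the conditional expected number of children by a multiple of
  \<open>1 + log n\<close>.
\<close>

section \<open>Azuma--Hoeffding for functions of independent variables\<close>

text \<open>The conditional expectation of \<open>f\<close> given the first \<open>k\<close>
  coordinates. The explicit integral over the other coordinates is a version defined at every
  \<open>x\<close>, so increments can be bounded pointwise rather than almost surely.\<close>

definition partial_mean ::
    "(nat \<Rightarrow> 'a measure) \<Rightarrow> nat \<Rightarrow> ((nat \<Rightarrow> 'a) \<Rightarrow> real) \<Rightarrow> nat \<Rightarrow> (nat \<Rightarrow> 'a) \<Rightarrow> real" where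
  "partial_mean M n f k x = (\<integral>z. f (merge {..<k} {k..<n} (x, z)) \<partial>Pi\<^sub>M {k..<n} M)"

locale prob_sequence =
  fixes M :: "nat \<Rightarrow> 'a measure"
  assumes prob_M: "\<And>i. prob_space (M i)"

sublocale prob_sequence \<subseteq> product_sigma_finite M
  by (intro product_sigma_finite.intro prob_space_imp_sigma_finite prob_M)

context prob_sequence
begin

lemma measurable_merge_lessThan:
  assumes "k \<le> n" and f: "f \<in> borel_measurable (Pi\<^sub>M {..<n} M)"
  shows "(\<lambda>p. f (merge {..<k} {k..<n} p)) \<in> borel_measurable (Pi\<^sub>M {..<k} M \<Otimes>\<^sub>M Pi\<^sub>M {k..<n} M)"
  using measurable_compose[OF measurable_merge[of "{..<k}" "{k..<n}"]] assms
  by (metis ivl_disj_un_one(2))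

lemma merge_lessThan_space:
  assumes "k \<le> n" "x \<in> space (Pi\<^sub>M {..<k} M)" "z \<in> space (Pi\<^sub>M {k..<n} M)"
  shows "merge {..<k} {k..<n} (x, z) \<in> space (Pi\<^sub>M {..<n} M)"
proof -
  have "merge {..<k} {k..<n} \<in> Pi\<^sub>M {..<k} M \<Otimes>\<^sub>M Pi\<^sub>M {k..<n} M \<rightarrow>\<^sub>M Pi\<^sub>M ({..<k} \<union> {k..<n}) M"
    by (rule measurable_merge)
  from measurable_space[OF this, of "(x, z)"] assms show ?thesis
    by (simp add: space_pair_measure ivl_disj_un_one(2))
qed

lemma borel_measurable_partial_mean:
  assumes "k \<le> n" "f \<in> borel_measurable (Pi\<^sub>M {..<n} M)"
  shows "partial_mean M n f k \<in> borel_measurable (Pi\<^sub>M {..<k} M)"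
proof -
  interpret S: prob_space "Pi\<^sub>M {k..<n} M" by (rule prob_space_PiM) (rule prob_M)
  have "(\<lambda>x. \<integral>z. f (merge {..<k} {k..<n} (x, z)) \<partial>Pi\<^sub>M {k..<n} M) \<in> borel_measurable (Pi\<^sub>M {..<k} M)"
    by (rule S.borel_measurable_lebesgue_integral)
      (use measurable_merge_lessThan[OF assms] in \<open>simp add: case_prod_unfold\<close>)
  then show ?thesis by (simp add: partial_mean_def[abs_def])
qed

lemma integrable_merge_lessThan:
  fixes f :: "(nat \<Rightarrow> 'a) \<Rightarrow> real"
  assumes "k \<le> n" "f \<in> borel_measurable (Pi\<^sub>M {..<n} M)"
    and B: "\<And>x. x \<in> space (Pi\<^sub>M {..<n} M) \<Longrightarrow> \<bar>f x\<bar> \<le> B"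
    and x: "x \<in> space (Pi\<^sub>M {..<k} M)"
  shows "integrable (Pi\<^sub>M {k..<n} M) (\<lambda>z. f (merge {..<k} {k..<n} (x, z)))"
proof -
  interpret S: prob_space "Pi\<^sub>M {k..<n} M" by (rule prob_space_PiM) (rule prob_M)
  show ?thesis
  proof (rule S.integrable_const_bound[where B = B])
    show "AE z in Pi\<^sub>M {k..<n} M. norm (f (merge {..<k} {k..<n} (x, z))) \<le> B"
      using B merge_lessThan_space[OF assms(1) x] by (intro AE_I2) auto
    show "(\<lambda>z. f (merge {..<k} {k..<n} (x, z))) \<in> borel_measurable (Pi\<^sub>M {k..<n} M)"
      using measurable_compose[OF measurable_Pair1'[OF x] measurable_merge_lessThan[OF assms(1,2)]]
      by simp
  qed
qed

lemma abs_partial_mean_le: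
  assumes "k \<le> n" "f \<in> borel_measurable (Pi\<^sub>M {..<n} M)"
    and B: "\<And>x. x \<in> space (Pi\<^sub>M {..<n} M) \<Longrightarrow> \<bar>f x\<bar> \<le> B"
    and x: "x \<in> space (Pi\<^sub>M {..<k} M)"
  shows "\<bar>partial_mean M n f k x\<bar> \<le> B"
proof -
  interpret S: prob_space "Pi\<^sub>M {k..<n} M" by (rule prob_space_PiM) (rule prob_M)
  have "\<bar>partial_mean M n f k x\<bar> \<le> (\<integral>z. \<bar>f (merge {..<k} {k..<n} (x, z))\<bar> \<partial>Pi\<^sub>M {k..<n} M)"
    unfolding partial_mean_def by (rule integral_abs_bound)
  also have "\<dots> \<le> (\<integral>z. B \<partial>Pi\<^sub>M {k..<n} M)"
    by (rule integral_mono)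
      (use integrable_merge_lessThan[OF assms] B merge_lessThan_space[OF assms(1) x] in auto)
  finally show ?thesis by (simp add: S.prob_space)
qed

text \<open>Fubini: among the coordinates from \<open>k\<close> on, coordinate \<open>k\<close> may
  be integrated out last. This is the martingale property.\<close>

lemma partial_mean_Suc:
  assumes k: "k < n" and f: "f \<in> borel_measurable (Pi\<^sub>M {..<n} M)"
    and B: "\<And>x. x \<in> space (Pi\<^sub>M {..<n} M) \<Longrightarrow> \<bar>f x\<bar> \<le> B"
    and x: "x \<in> space (Pi\<^sub>M {..<k} M)"
  shows "partial_mean M n f k x = (\<integral>y. partial_mean M n f (Suc k) (x(k := y)) \<partial>M k)"
proof -
  have un: "{k..<n} = {k} \<union> {Suc k..<n}" using k by auto
  have m: "merge {..<k} ({k} \<union> {Suc k..<n}) (x, merge {k} {Suc k..<n} (u, z))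
     = merge {..<Suc k} {Suc k..<n} (x(k := u k), z)" for u z
    by (auto simp: merge_def fun_eq_iff)
  have int: "integrable (Pi\<^sub>M ({k} \<union> {Suc k..<n}) M) (\<lambda>z. f (merge {..<k} ({k} \<union> {Suc k..<n}) (x, z)))"
    unfolding un[symmetric] by (rule integrable_merge_lessThan[OF less_imp_le[OF k] f B x])
  have "partial_mean M n f k x =
    (\<integral>z. f (merge {..<k} ({k} \<union> {Suc k..<n}) (x, z)) \<partial>Pi\<^sub>M ({k} \<union> {Suc k..<n}) M)"
    unfolding partial_mean_def un[symmetric] by simp
  also have "\<dots> = (\<integral>u. (\<integral>z. f (merge {..<k} ({k} \<union> {Suc k..<n}) (x, merge {k} {Suc k..<n} (u, z)))
      \<partial>Pi\<^sub>M {Suc k..<n} M) \<partial>Pi\<^sub>M {k} M)"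
    by (rule product_integral_fold) (use int in auto)
  also have "\<dots> = (\<integral>u. partial_mean M n f (Suc k) (x(k := u k)) \<partial>Pi\<^sub>M {k} M)"
    unfolding m partial_mean_def ..
  also have "\<dots> = (\<integral>y. partial_mean M n f (Suc k) (x(k := y)) \<partial>M k)"
  proof (rule product_integral_singleton)
    have "(\<lambda>y. x(k := y)) \<in> measurable (M k) (Pi\<^sub>M (insert k {..<k}) M)"
      by (rule measurable_component_update) (use x in auto)
    then show "(\<lambda>y. partial_mean M n f (Suc k) (x(k := y))) \<in> borel_measurable (M k)"
      using borel_measurable_partial_mean[OF Suc_leI[OF k] f]
      by (auto simp: lessThan_Suc intro: measurable_compose)
  qed
  finally show ?thesis .
qed

text \<open>The martingale \<open>partial_mean M n f k\<close> has conditionally centred increments bounded by \<open>c\<close>, so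
  Hoeffding's lemma integrates out one coordinate at a time.\<close>

lemma nn_integral_exp_partial_mean:
  assumes f: "f \<in> borel_measurable (Pi\<^sub>M {..<n} M)"
    and B: "\<And>x. x \<in> space (Pi\<^sub>M {..<n} M) \<Longrightarrow> \<bar>f x\<bar> \<le> B"
    and diff: "\<And>k x y y'. k < n \<Longrightarrow> x \<in> space (Pi\<^sub>M {..<k} M) \<Longrightarrow> y \<in> space (M k) \<Longrightarrow> y' \<in> space (M k) \<Longrightarrow>
      \<bar>partial_mean M n f (Suc k) (x(k := y)) - partial_mean M n f (Suc k) (x(k := y'))\<bar> \<le> c"
    and s: "0 < s" and k: "k \<le> n"
  shows "(\<integral>\<^sup>+x. exp (s * partial_mean M n f k x) \<partial>Pi\<^sub>M {..<k} M)
    \<le> ennreal (exp (s * partial_mean M n f 0 (\<lambda>_. undefined) + real k * (s\<^sup>2 * c\<^sup>2 / 2)))"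
  using k
proof (induction k)
  case 0
  \<comment> \<open>A product over no indices is the point mass at the everywhere
    \<open>undefined\<close> function, so equality holds.\<close>
  show ?case by (simp add: nn_integral_empty space_PiM)
next
  case (Suc k)
  let ?A = "partial_mean M n f"
  from Suc.prems have k: "k < n" by simp
  have meas: "(\<lambda>x. ?A (Suc k) x) \<in> borel_measurable (Pi\<^sub>M (insert k {..<k}) M)"
    using borel_measurable_partial_mean[OF Suc.prems f] by (simp add: lessThan_Suc)
  have inner: "(\<integral>\<^sup>+y. exp (s * ?A (Suc k) (x(k := y))) \<partial>M k)
      \<le> ennreal (exp (s * ?A k x)) * ennreal (exp (s\<^sup>2 * c\<^sup>2 / 2))"
    if x: "x \<in> space (Pi\<^sub>M {..<k} M)" for x
  proof -
    interpret Mk: prob_space "M k" by (rule prob_M)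
    have upd: "x(k := y) \<in> space (Pi\<^sub>M {..<Suc k} M)" if "y \<in> space (M k)" for y
      using x that by (auto simp: space_PiM lessThan_Suc PiE_iff extensional_def)
    have Ym: "(\<lambda>y. ?A (Suc k) (x(k := y))) \<in> borel_measurable (M k)"
      by (rule measurable_compose[OF measurable_component_update meas]) (use x in auto)
    have Yi: "integrable (M k) (\<lambda>y. ?A (Suc k) (x(k := y)))"
      by (rule Mk.integrable_const_bound[where B = B])
        (use Ym upd abs_partial_mean_le[OF Suc.prems f B] in auto)
    have mean: "?A k x = (\<integral>y. ?A (Suc k) (x(k := y)) \<partial>M k)"
      by (rule partial_mean_Suc[OF k f B x])
    \<comment> \<open>By the martingale property the increment is the average over \<open>y'\<close>
      of the differences between two values of coordinate \<open>k\<close>, so the bound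
      \<open>c\<close> carries over to it.\<close>
    have dev: "\<bar>?A (Suc k) (x(k := y)) - ?A k x\<bar> \<le> c" if y: "y \<in> space (M k)" for y
    proof -
      have eq: "?A (Suc k) (x(k := y)) - ?A k x
          = (\<integral>y'. ?A (Suc k) (x(k := y)) - ?A (Suc k) (x(k := y')) \<partial>M k)"
        unfolding mean using Yi by (simp add: Mk.prob_space)
      have "\<bar>?A (Suc k) (x(k := y)) - ?A k x\<bar>
          \<le> (\<integral>y'. \<bar>?A (Suc k) (x(k := y)) - ?A (Suc k) (x(k := y'))\<bar> \<partial>M k)"
        unfolding eq by (rule integral_abs_bound)
      also have "\<dots> \<le> (\<integral>y'. c \<partial>M k)"
        by (rule integral_mono) (use Yi diff[OF k x y] in simp_all)
      finally show ?thesis by (simp add: Mk.prob_space)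
    qed
    interpret Y: interval_bounded_random_variable "M k" "\<lambda>y. ?A (Suc k) (x(k := y)) - ?A k x" "-c" c
    proof unfold_locales
      show "AE y in M k. ?A (Suc k) (x(k := y)) - ?A k x \<in> {- c..c}"
        using dev by (intro AE_I2) (force simp: abs_le_iff)
    qed (use Ym in auto)
    have "(\<integral>\<^sup>+y. exp (s * ?A (Suc k) (x(k := y))) \<partial>M k)
      = (\<integral>\<^sup>+y. ennreal (exp (s * ?A k x)) * ennreal (exp (s * (?A (Suc k) (x(k := y)) - ?A k x))) \<partial>M k)"
      by (intro nn_integral_cong) (simp add: right_diff_distrib flip: ennreal_mult exp_add)
    also have "\<dots> = ennreal (exp (s * ?A k x)) *
        (\<integral>\<^sup>+y. ennreal (exp (s * (?A (Suc k) (x(k := y)) - ?A k x))) \<partial>M k)"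
      by (rule nn_integral_cmult) (use Ym in measurable)
    \<comment> \<open>Hoeffding's lemma for a centred variable in an interval of width
      \<open>2 * c\<close>.\<close>
    also have "\<dots> \<le> ennreal (exp (s * ?A k x)) * ennreal (exp (s\<^sup>2 * (c - - c)\<^sup>2 / 8))"
      by (intro mult_left_mono Y.Hoeffdings_lemma_nn_integral_0 s)
        (use mean Yi in \<open>simp_all add: Mk.prob_space\<close>)
    also have "s\<^sup>2 * (c - - c)\<^sup>2 / 8 = s\<^sup>2 * c\<^sup>2 / 2" by (simp add: power2_eq_square)
    finally show ?thesis .
  qed
  have "(\<integral>\<^sup>+x. exp (s * ?A (Suc k) x) \<partial>Pi\<^sub>M {..<Suc k} M)
      = (\<integral>\<^sup>+x. (\<integral>\<^sup>+y. exp (s * ?A (Suc k) (x(k := y))) \<partial>M k) \<partial>Pi\<^sub>M {..<k} M)"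
    unfolding lessThan_Suc by (rule product_nn_integral_insert) (use meas in measurable)
  also have "\<dots> \<le> (\<integral>\<^sup>+x. ennreal (exp (s * ?A k x)) * ennreal (exp (s\<^sup>2 * c\<^sup>2 / 2)) \<partial>Pi\<^sub>M {..<k} M)"
    by (rule nn_integral_mono) (rule inner)
  also have "\<dots> = (\<integral>\<^sup>+x. ennreal (exp (s * ?A k x)) \<partial>Pi\<^sub>M {..<k} M) * ennreal (exp (s\<^sup>2 * c\<^sup>2 / 2))"
    by (rule nn_integral_multc) (use borel_measurable_partial_mean[OF less_imp_le[OF k] f] in measurable)
  also have "\<dots> \<le> ennreal (exp (s * ?A 0 (\<lambda>_. undefined) + real k * (s\<^sup>2 * c\<^sup>2 / 2))) * ennreal (exp (s\<^sup>2 * c\<^sup>2 / 2))"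
    by (intro mult_right_mono Suc.IH) (use k in auto)
  also have "\<dots> = ennreal (exp (s * ?A 0 (\<lambda>_. undefined) + real (Suc k) * (s\<^sup>2 * c\<^sup>2 / 2)))"
    by (simp add: algebra_simps flip: ennreal_mult exp_add)
  finally show ?case .
qed

text \<open>Points of a product space are \<open>undefined\<close> off the index set, so merging
  with an empty block changes nothing. The martingale therefore runs from the mean of
  \<open>f\<close> to \<open>f\<close> itself.\<close>

lemma
  shows partial_mean_0: "partial_mean M n f 0 x = (\<integral>x. f x \<partial>Pi\<^sub>M {..<n} M)"
    and partial_mean_full: "x \<in> space (Pi\<^sub>M {..<n} M) \<Longrightarrow> partial_mean M n f n x = f x"
proof -
  interpret S: prob_space "Pi\<^sub>M {} M" by (rule prob_space_PiM) simp
  have "merge {} {0..<n} (x, z) = z" if "z \<in> space (Pi\<^sub>M {0..<n} M)" for z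
    using that by (auto simp: merge_def space_PiM PiE_def extensional_def)
  then show "partial_mean M n f 0 x = (\<integral>x. f x \<partial>Pi\<^sub>M {..<n} M)"
    unfolding partial_mean_def by (simp add: lessThan_atLeast0 cong: Bochner_Integration.integral_cong)
  assume "x \<in> space (Pi\<^sub>M {..<n} M)"
  then have "merge {..<n} {} (x, z) = x" for z
    by (auto simp: merge_def space_PiM PiE_def extensional_def)
  then show "partial_mean M n f n x = f x"
    unfolding partial_mean_def by (simp add: S.prob_space)
qed

section \<open>Tail bounds from the exponential moment\<close>

lemma azuma_hoeffding_upper:
  assumes f: "f \<in> borel_measurable (Pi\<^sub>M {..<n} M)"
    and B: "\<And>x. x \<in> space (Pi\<^sub>M {..<n} M) \<Longrightarrow> \<bar>f x\<bar> \<le> B"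
    and diff: "\<And>k x y y'. k < n \<Longrightarrow> x \<in> space (Pi\<^sub>M {..<k} M) \<Longrightarrow> y \<in> space (M k) \<Longrightarrow> y' \<in> space (M k) \<Longrightarrow>
      \<bar>partial_mean M n f (Suc k) (x(k := y)) - partial_mean M n f (Suc k) (x(k := y'))\<bar> \<le> c"
    and t: "0 < t" and c: "0 < c" and n: "0 < n"
  shows "measure (Pi\<^sub>M {..<n} M) {x \<in> space (Pi\<^sub>M {..<n} M). (\<integral>x. f x \<partial>Pi\<^sub>M {..<n} M) + t \<le> f x}
    \<le> exp (- (t\<^sup>2 / (2 * real n * c\<^sup>2)))"
proof -
  let ?P = "Pi\<^sub>M {..<n} M"
  let ?mu = "\<integral>x. f x \<partial>?P"
  interpret P: prob_space ?P by (rule prob_space_PiM) (rule prob_M)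
  \<comment> \<open>The minimiser of the Chernoff exponent
    \<open>- s * t + real n * (s\<^sup>2 * c\<^sup>2 / 2)\<close>.\<close>
  define s where "s = t / (real n * c\<^sup>2)"
  have s: "0 < s" using t c n by (simp add: s_def)
  have "ennreal (P.prob {x \<in> space ?P. ?mu + t \<le> f x})
      \<le> ennreal (exp (- s * (?mu + t))) * (\<integral>\<^sup>+x. ennreal (exp (s * f x)) * indicator (space ?P) x \<partial>?P)"
    unfolding P.emeasure_eq_measure[symmetric]
    by (rule Chernoff_ineq_nn_integral_ge[OF s]) (use f in auto)
  also have "(\<integral>\<^sup>+x. ennreal (exp (s * f x)) * indicator (space ?P) x \<partial>?P)
      = (\<integral>\<^sup>+x. exp (s * partial_mean M n f n x) \<partial>?P)"
    by (intro nn_integral_cong) (simp add: partial_mean_full)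
  also have "ennreal (exp (- s * (?mu + t))) * (\<integral>\<^sup>+x. exp (s * partial_mean M n f n x) \<partial>?P)
      \<le> ennreal (exp (- s * (?mu + t))) * ennreal (exp (s * ?mu + real n * (s\<^sup>2 * c\<^sup>2 / 2)))"
    using nn_integral_exp_partial_mean[OF f B diff s order_refl]
    by (intro mult_left_mono) (simp_all add: partial_mean_0)
  also have "\<dots> = ennreal (exp (- s * t + real n * (s\<^sup>2 * c\<^sup>2 / 2)))"
    by (simp add: algebra_simps flip: ennreal_mult exp_add)
  finally have "P.prob {x \<in> space ?P. ?mu + t \<le> f x} \<le> exp (- s * t + real n * (s\<^sup>2 * c\<^sup>2 / 2))"
    by simp
  also have "- s * t + real n * (s\<^sup>2 * c\<^sup>2 / 2) = - (t\<^sup>2 / (2 * real n * c\<^sup>2))"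
    using c n by (simp add: s_def field_simps power2_eq_square)
  finally show ?thesis .
qed

lemma partial_mean_uminus: "partial_mean M n (\<lambda>x. - f x) k x = - partial_mean M n f k x"
  by (simp add: partial_mean_def)

theorem azuma_hoeffding:
  assumes f: "f \<in> borel_measurable (Pi\<^sub>M {..<n} M)"
    and B: "\<And>x. x \<in> space (Pi\<^sub>M {..<n} M) \<Longrightarrow> \<bar>f x\<bar> \<le> B"
    and diff: "\<And>k x y y'. k < n \<Longrightarrow> x \<in> space (Pi\<^sub>M {..<k} M) \<Longrightarrow> y \<in> space (M k) \<Longrightarrow> y' \<in> space (M k) \<Longrightarrow>
      \<bar>partial_mean M n f (Suc k) (x(k := y)) - partial_mean M n f (Suc k) (x(k := y'))\<bar> \<le> c"
    and t: "0 \<le> t" and c: "0 < c" and n: "0 < n"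
  shows "measure (Pi\<^sub>M {..<n} M) {x \<in> space (Pi\<^sub>M {..<n} M). t \<le> \<bar>f x - (\<integral>x. f x \<partial>Pi\<^sub>M {..<n} M)\<bar>}
    \<le> 2 * exp (- (t\<^sup>2 / (2 * real n * c\<^sup>2)))"
\<comment> \<open>The Chernoff parameter has to be positive, so \<open>t = 0\<close> is treated
  apart; there the right-hand side equals 2.\<close>
proof (cases "t = 0")
  case True
  interpret P: prob_space "Pi\<^sub>M {..<n} M" by (rule prob_space_PiM) (rule prob_M)
  show ?thesis using True by (simp add: P.prob_space)
next
  case False
  then have t: "0 < t" using t by simp
  let ?P = "Pi\<^sub>M {..<n} M"
  let ?mu = "\<integral>x. f x \<partial>?P"
  interpret P: prob_space ?P by (rule prob_space_PiM) (rule prob_M)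
  let ?U = "{x \<in> space ?P. ?mu + t \<le> f x}"
  let ?D = "{x \<in> space ?P. (\<integral>x. - f x \<partial>?P) + t \<le> - f x}"
  have U: "P.prob ?U \<le> exp (- (t\<^sup>2 / (2 * real n * c\<^sup>2)))"
    by (rule azuma_hoeffding_upper[OF f B diff t c n])
  \<comment> \<open>The lower tail of \<open>f\<close> is the upper tail of \<open>- f\<close>,
    whose martingale differs only by the sign.\<close>
  have D: "P.prob ?D \<le> exp (- (t\<^sup>2 / (2 * real n * c\<^sup>2)))"
  proof (rule azuma_hoeffding_upper[OF _ _ _ t c n])
    show "\<bar>partial_mean M n (\<lambda>x. - f x) (Suc k) (x(k := y)) - partial_mean M n (\<lambda>x. - f x) (Suc k) (x(k := y'))\<bar> \<le> c"
      if "k < n" "x \<in> space (Pi\<^sub>M {..<k} M)" "y \<in> space (M k)" "y' \<in> space (M k)" for k x y y'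
      using diff[OF that(1,2,4,3)] by (simp add: partial_mean_uminus)
  qed (use f B in auto)
  have "P.prob {x \<in> space ?P. t \<le> \<bar>f x - ?mu\<bar>} \<le> P.prob (?U \<union> ?D)"
    using f by (intro P.finite_measure_mono) auto
  also have "\<dots> \<le> P.prob ?U + P.prob ?D"
    using f by (intro measure_Un_le) auto
  finally show ?thesis using U D by simp
qed

end

section \<open>Exchangeability\<close>

text \<open>The events that \<open>l\<close> is the strict minimiser, for \<open>l\<close> in
  \<open>I\<close>, are pairwise disjoint, since two strict minimisers would each have to beat the
  other. Swapping two coordinates shows that they are equally likely. The predicate \<open>p\<close>
  restricts the competition to a random subset of \<open>I\<close>; below it selects one direction
  cell.\<close>

lemma prob_strict_minimum_le:
  fixes N :: "'a measure" and h :: "'a \<Rightarrow> real"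
  assumes N: "prob_space N" and J: "finite J" "I \<subseteq> J" and i: "i \<in> I"
    and p [measurable]: "Measurable.pred N p" and h [measurable]: "h \<in> borel_measurable N"
  shows "measure (Pi\<^sub>M J (\<lambda>_. N)) {\<omega> \<in> space (Pi\<^sub>M J (\<lambda>_. N)).
    p (\<omega> i) \<and> (\<forall>m\<in>I - {i}. p (\<omega> m) \<longrightarrow> h (\<omega> i) < h (\<omega> m))} \<le> 1 / real (card I)"
proof -
  let ?P = "Pi\<^sub>M J (\<lambda>_. N)"
  interpret P: prob_space ?P by (rule prob_space_PiM) (rule N)
  define E where "E l = {\<omega> \<in> space ?P. p (\<omega> l) \<and> (\<forall>m\<in>I - {l}. p (\<omega> m) \<longrightarrow> h (\<omega> l) < h (\<omega> m))}" for l
  have I: "finite I" using J finite_subset by blast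
  have E_meas: "E l \<in> sets ?P" if "l \<in> I" for l
  proof -
    have [measurable]: "(\<lambda>\<omega>. \<omega> m) \<in> measurable ?P N" if "m \<in> I" for m
      using that J by (intro measurable_component_singleton) auto
    have [measurable]: "finite (I - {l})" using I by simp
    have "Measurable.pred ?P (\<lambda>\<omega>. p (\<omega> l) \<and> (\<forall>m\<in>I - {l}. p (\<omega> m) \<longrightarrow> h (\<omega> l) < h (\<omega> m)))"
      using that by measurable
    then show ?thesis by (simp add: E_def pred_def)
  qed
  have disj: "disjoint_family_on E I"
    unfolding disjoint_family_on_def E_def by (force dest: less_asym)
  have eq: "P.prob (E l) = P.prob (E i)" if l: "l \<in> I" for l
  proof -
    \<comment> \<open>\<open>T\<close> swaps coordinates \<open>i\<close> and \<open>l\<close>. It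
      preserves the product measure and carries the competitors of \<open>i\<close> to those of
      \<open>l\<close>, so the preimage of \<open>E i\<close> is \<open>E l\<close>.\<close>
    define T where "T \<omega> = (\<lambda>m\<in>J. \<omega> (Transposition.transpose i l m))" for \<omega> :: "'b \<Rightarrow> 'a"
    have tJ: "Transposition.transpose i l m \<in> J" if "m \<in> J" for m
      using that i l J by (auto simp: Transposition.transpose_def)
    have T: "distr ?P ?P T = ?P"
      unfolding T_def
      by (rule distr_PiM_reindex) (use N tJ in \<open>auto intro: inj_on_subset[OF inj_transpose]\<close>)
    have Tm: "T \<in> measurable ?P ?P"
      unfolding T_def by (intro measurable_restrict measurable_component_singleton tJ)
    have "T \<omega> \<in> E i \<longleftrightarrow> \<omega> \<in> E l" if w: "\<omega> \<in> space ?P" for \<omega>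
    proof -
      have "T \<omega> \<in> space ?P" using measurable_space[OF Tm w] .
      moreover have "T \<omega> m = \<omega> (Transposition.transpose i l m)" if "m \<in> I" for m
        using that J by (auto simp: T_def)
      moreover have "I - {l} = Transposition.transpose i l ` (I - {i})"
      proof -
        have "bij_betw (Transposition.transpose i l) I I"
          using i l by (intro bij_betw_byWitness[where f' = "Transposition.transpose i l"])
            (auto simp: Transposition.transpose_def)
        then have "Transposition.transpose i l ` (I - {i}) = I - {Transposition.transpose i l i}"
          using i by (auto simp: bij_betw_def inj_on_image_set_diff[of _ I])
        then show ?thesis by simp
      qed
      ultimately show ?thesis using w i by (auto simp: E_def)
    qed
    then have "T -` E i \<inter> space ?P = E l"
      by (auto simp: E_def)
    then have "P.prob (E l) = measure (distr ?P ?P T) (E i)"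
      using Tm E_meas[OF i] by (simp add: measure_distr)
    then show ?thesis unfolding T .
  qed
  have "real (card I) * P.prob (E i) = (\<Sum>l\<in>I. P.prob (E l))"
    using eq by simp
  also have "\<dots> = P.prob (\<Union>l\<in>I. E l)"
    using E_meas disj I by (intro P.finite_measure_finite_Union[symmetric]) auto
  also have "\<dots> \<le> 1" by (rule P.prob_le_1)
  finally have "real (card I) * P.prob (E i) \<le> 1" .
  moreover have "0 < card I" using i I by (auto simp: card_gt_0_iff)
  ultimately show ?thesis by (simp add: E_def field_simps)
qed

section \<open>Torus geometry\<close>

text \<open>The representative of \<open>x - y\<close> modulo the lattice in the cube centred at the origin: an explicit, hence
  measurable, choice of a shortest one.\<close>

definition torus_diff :: "nat \<Rightarrow> real^'d::finite \<Rightarrow> real^'d \<Rightarrow> real^'d" where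
  "torus_diff n x y = (\<chi> i. x $ i - y $ i
     - torus_side TYPE('d) n * of_int \<lfloor>(x $ i - y $ i) / torus_side TYPE('d) n + 1 / 2\<rfloor>)"

lemma torus_diff_lattice:
  obtains z where "z \<in> torus_lattice n" "x - y = torus_diff n x y + z"
proof
  show "(\<chi> i. torus_side TYPE('a) n * of_int ((\<chi> i. \<lfloor>(x $ i - y $ i) / torus_side TYPE('a) n + 1 / 2\<rfloor>) $ i))
      \<in> (torus_lattice n :: (real^'a) set)"
    unfolding torus_lattice_def by blast
qed (simp add: torus_diff_def vec_eq_iff)

lemma torus_lattice_diff:
  assumes "z \<in> torus_lattice n" "w \<in> torus_lattice n"
  shows "z - w \<in> torus_lattice n"
proof -
  obtain k l where "z = (\<chi> i. torus_side TYPE('a) n * of_int (k $ i))"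
    "w = (\<chi> i. torus_side TYPE('a) n * of_int (l $ i))"
    using assms unfolding torus_lattice_def by blast
  then have "z - w = (\<chi> i. torus_side TYPE('a) n * of_int ((k - l) $ i))"
    by (simp add: vec_eq_iff algebra_simps)
  then show ?thesis unfolding torus_lattice_def by blast
qed

lemma torus_dist_le:
  assumes "z \<in> torus_lattice n"
  shows "torus_dist n x y \<le> norm (x - y - z)"
proof -
  have "torus_dist n x y \<le> dist x (y + z)"
    unfolding torus_dist_def by (rule cINF_lower) (use assms in \<open>auto intro: bdd_belowI[where m = 0]\<close>)
  then show ?thesis by (simp add: dist_norm algebra_simps)
qed

text \<open>The difference of the two representatives relative to \<open>y\<close> represents
  \<open>x - x'\<close> modulo the lattice. Distances between points seen from \<open>y\<close> can
  thus be bounded by Euclidean geometry around the origin.\<close>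

lemma torus_dist_le_norm_diff:
  "torus_dist n x x' \<le> norm (torus_diff n x y - torus_diff n x' y)"
proof -
  obtain z where z: "z \<in> torus_lattice n" "x - y = torus_diff n x y + z"
    by (rule torus_diff_lattice)
  obtain w where w: "w \<in> torus_lattice n" "x' - y = torus_diff n x' y + w"
    by (rule torus_diff_lattice)
  have "x - x' - (z - w) = torus_diff n x y - torus_diff n x' y"
    using arg_cong2[OF z(2) w(2), of minus] by (simp add: algebra_simps)
  then show ?thesis using torus_dist_le[OF torus_lattice_diff[OF z(1) w(1)], of x x'] by simp
qed

text \<open>The floor expression is \<open>round (u / s)\<close>, and rounding gives a nearest
  integer.\<close>

lemma abs_diff_round_le:
  fixes u s :: real and k :: int
  assumes "0 < s"
  shows "\<bar>u - s * of_int \<lfloor>u / s + 1 / 2\<rfloor>\<bar> \<le> \<bar>u - s * of_int k\<bar>"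
proof -
  have "\<bar>of_int (round (u / s)) - u / s\<bar> \<le> \<bar>of_int k - u / s\<bar>"
    using round_diff_minimal[of "u / s" k] by (simp add: abs_minus_commute)
  then have "s * \<bar>u / s - of_int (round (u / s))\<bar> \<le> s * \<bar>u / s - of_int k\<bar>"
    using assms by (simp add: abs_minus_commute)
  then have "\<bar>s * (u / s - of_int (round (u / s)))\<bar> \<le> \<bar>s * (u / s - of_int k)\<bar>"
    using assms by (simp add: abs_mult)
  then show ?thesis using assms by (simp add: right_diff_distrib round_def)
qed

text \<open>The lattice is a product of one-dimensional lattices, so rounding each coordinate
  separately minimises every coordinate at once, hence the norm.\<close>

lemma torus_dist_eq_norm_diff:
  fixes x y :: "real^'d::finite"
  assumes "0 < n"
  shows "torus_dist n x y = norm (torus_diff n x y)"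
proof (rule antisym)
  obtain z where z: "z \<in> torus_lattice n" "x - y = torus_diff n x y + z"
    by (rule torus_diff_lattice)
  then show "torus_dist n x y \<le> norm (torus_diff n x y)"
    using torus_dist_le[OF z(1), of x y] by simp
  have s: "0 < torus_side TYPE('d) n" using assms by (simp add: torus_side_def)
  show "norm (torus_diff n x y) \<le> torus_dist n x y"
    unfolding torus_dist_def
  proof (rule cINF_greatest)
    show "torus_lattice n \<noteq> ({} :: (real^'d) set)" using z(1) by auto
  next
    fix w :: "real^'d" assume "w \<in> torus_lattice n"
    then obtain k where w: "w = (\<chi> i. torus_side TYPE('d) n * of_int (k $ i))"
      unfolding torus_lattice_def by (rule rangeE)
    show "norm (torus_diff n x y) \<le> dist x (y + w)"
      unfolding dist_norm
    proof (rule norm_le_componentwise_cart)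
      fix i
      have "(x - (y + w)) $ i = x $ i - y $ i - torus_side TYPE('d) n * of_int (k $ i)"
        by (simp add: w)
      then show "norm (torus_diff n x y $ i) \<le> norm ((x - (y + w)) $ i)"
        using abs_diff_round_le[OF s, of "x $ i - y $ i" "k $ i"] by (simp add: torus_diff_def)
    qed
  qed
qed

text \<open>Directions are sorted into grid cells of side \<open>1/d\<close>, so that two unit vectors in a common
  cell are at distance less than \<open>1\<close>. Junk: for \<open>v = 0\<close> the division gives the cell of \<open>0\<close>, which
  contains no unit vector.\<close>

definition direction_cell :: "real^'d::finite \<Rightarrow> 'd \<Rightarrow> int" where
  "direction_cell v i = \<lfloor>real CARD('d) * (v $ i / norm v)\<rfloor>"

text \<open>Coordinates of a unit vector lie between -1 and 1. The number of cells depends on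
  \<open>d\<close> only and becomes the constant \<open>K\<close> of the increment bound.\<close>

lemma finite_range_direction_cell: "finite (range (direction_cell :: real^'d::finite \<Rightarrow> _))"
proof (rule finite_subset)
  show "range (direction_cell :: real^'d \<Rightarrow> _) \<subseteq> (\<Pi>\<^sub>E i\<in>UNIV. {- int CARD('d)..int CARD('d)})"
  proof (intro image_subsetI PiE_I)
    fix v :: "real^'d" and i :: 'd
    have "\<bar>v $ i / norm v\<bar> \<le> 1"
      using component_le_norm_cart[of v i] by (auto simp: divide_le_eq_1)
    then have "\<bar>real CARD('d) * (v $ i / norm v)\<bar> \<le> real CARD('d)"
      using mult_left_le[of "\<bar>v $ i / norm v\<bar>" "real CARD('d)"] by (simp only: abs_mult) simp
    then show "direction_cell v i \<in> {- int CARD('d)..int CARD('d)}"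
      unfolding direction_cell_def atLeastAtMost_iff le_floor_iff floor_le_iff abs_le_iff
      by (simp only: of_int_minus of_int_of_nat_eq) linarith
  qed auto
qed (auto intro: finite_PiE)

text \<open>Coordinates in a common cell differ by less than \<open>1/d\<close>, and the norm is at
  most the sum of the \<open>d\<close> coordinate differences.\<close>

lemma norm_unit_diff_less_1:
  fixes v w :: "real^'d::finite"
  assumes "direction_cell v = direction_cell w"
  shows "norm (v /\<^sub>R norm v - w /\<^sub>R norm w) < 1"
proof -
  let ?u = "v /\<^sub>R norm v - w /\<^sub>R norm w" and ?D = "real CARD('d)"
  have "\<bar>?u $ i\<bar> < 1 / ?D" for i
  proof -
    have "\<lfloor>?D * (v $ i / norm v)\<rfloor> = \<lfloor>?D * (w $ i / norm w)\<rfloor>"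
      using fun_cong[OF assms, of i] by (simp add: direction_cell_def)
    then have "\<bar>?D * (v $ i / norm v) - ?D * (w $ i / norm w)\<bar> < 1" by linarith
    then have "?D * \<bar>?u $ i\<bar> < 1"
      by (simp add: divide_inverse mult.commute flip: right_diff_distrib abs_mult)
    then show ?thesis by (simp add: field_simps)
  qed
  then have "(\<Sum>i\<in>UNIV. \<bar>?u $ i\<bar>) < (\<Sum>i\<in>(UNIV :: 'd set). 1 / ?D)"
    by (intro sum_strict_mono) auto
  then show ?thesis using norm_le_l1_cart[of ?u] by simp
qed

lemma norm_diff_less_if_same_cell:
  fixes v w :: "real^'d::finite"
  assumes cell: "direction_cell v = direction_cell w" and v: "v \<noteq> 0" and le: "norm w \<le> norm v"
  shows "norm (v - w) < norm v"
proof -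
  let ?p = "v /\<^sub>R norm v" and ?q = "w /\<^sub>R norm w"
  have pq: "norm (?p - ?q) < 1" by (rule norm_unit_diff_less_1[OF cell])
  have p: "norm ?p = 1" using v by simp
  \<comment> \<open>For \<open>w = 0\<close> the difference would be the unit vector
    \<open>?p\<close>, of norm 1.\<close>
  have w: "w \<noteq> 0" using pq p by auto
  \<comment> \<open>Going from \<open>w\<close> to \<open>v\<close>: first turn to the direction of
    \<open>v\<close> at length \<open>norm w\<close>, which costs less than \<open>norm w\<close>,
    then stretch along that direction.\<close>
  have "v - w = (norm v - norm w) *\<^sub>R ?p + norm w *\<^sub>R (?p - ?q)"
    using v w by (simp add: algebra_simps)
  also have "norm \<dots> \<le> norm ((norm v - norm w) *\<^sub>R ?p) + norm (norm w *\<^sub>R (?p - ?q))"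
    by (rule norm_triangle_ineq)
  also have "\<dots> = (norm v - norm w) + norm w * norm (?p - ?q)"
    using le p by simp
  also have "\<dots> < (norm v - norm w) + norm w * 1"
    using pq w by (intro add_strict_left_mono mult_strict_left_mono) auto
  finally show ?thesis by simp
qed

section \<open>Children of a vertex\<close>

lemma nn_parent_dist_le:
  assumes "0 < i" "k < i"
  shows "torus_dist n (X i) (X (nn_parent n X i)) \<le> torus_dist n (X i) (X k)"
proof -
  let ?f = "\<lambda>j. torus_dist n (X i) (X j)"
  have "finite (?f ` {..<i})" "?f ` {..<i} \<noteq> {}" using assms by auto
  then have "Min (?f ` {..<i}) \<in> ?f ` {..<i}" by (rule Min_in)
  then obtain j where j: "j < i" "?f j = Min (?f ` {..<i})" by auto
  have "j < i \<and> (\<forall>k<i. ?f j \<le> ?f k)" using j by simp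
  then show ?thesis unfolding nn_parent_def by (rule LeastI2) (use assms in auto)
qed

lemma nn_parent_le:
  assumes "j < i" "\<And>k. k < i \<Longrightarrow> torus_dist n (X i) (X j) \<le> torus_dist n (X i) (X k)"
  shows "nn_parent n X i \<le> j"
  unfolding nn_parent_def by (rule Least_le) (use assms in auto)

text \<open>The first disjunct is the null event that \<open>X j\<close> and \<open>y\<close> are the same point of the torus.\<close>

definition cell_record :: "nat \<Rightarrow> nat \<Rightarrow> real^'d::finite \<Rightarrow> (nat \<Rightarrow> real^'d) \<Rightarrow> nat \<Rightarrow> bool" where
  "cell_record n k y X j \<longleftrightarrow> torus_diff n (X j) y = 0 \<or>
     (\<forall>m\<in>{k<..<j}. direction_cell (torus_diff n (X m) y) = direction_cell (torus_diff n (X j) y)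
        \<longrightarrow> norm (torus_diff n (X j) y) < norm (torus_diff n (X m) y))"

text \<open>A point \<open>m\<close> between \<open>k\<close> and \<open>j\<close> in the cell of
  \<open>j\<close>, no farther from \<open>k\<close> than \<open>j\<close> is, would be strictly
  closer to \<open>j\<close> than \<open>k\<close> is, so \<open>k\<close> could not be the
  parent.\<close>

lemma cell_record_if_child:
  assumes n: "0 < n" and k: "k < j" and par: "nn_parent n X j = k"
  shows "cell_record n k (X k) X j"
proof -
  let ?v = "\<lambda>m. torus_diff n (X m) (X k)"
  have "norm (?v j) < norm (?v m)"
    if nz: "?v j \<noteq> 0" and m: "m \<in> {k<..<j}" and cell: "direction_cell (?v m) = direction_cell (?v j)" for m
  proof (rule ccontr)
    assume "\<not> norm (?v j) < norm (?v m)"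
    then have "norm (?v j - ?v m) < norm (?v j)"
      using norm_diff_less_if_same_cell[OF cell[symmetric] nz] by simp
    then have "torus_dist n (X j) (X m) < torus_dist n (X j) (X k)"
      using torus_dist_le_norm_diff[of n "X j" "X m" "X k"] n by (simp add: torus_dist_eq_norm_diff)
    moreover have "torus_dist n (X j) (X k) \<le> torus_dist n (X j) (X m)"
      using nn_parent_dist_le[of j m n X] m par by simp
    ultimately show False by simp
  qed
  then show ?thesis unfolding cell_record_def by blast
qed

text \<open>A parent other than \<open>k\<close> is a candidate at the same distance in both
  configurations, so each parent is a minimiser in the other one. Breaking ties by the least index
  then gives both inequalities.\<close>

lemma nn_parent_cong:
  assumes eq: "\<And>m. m \<noteq> k \<Longrightarrow> X m = Y m" and i: "0 < i" "i \<noteq> k"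
    and par: "nn_parent n X i \<noteq> k" "nn_parent n Y i \<noteq> k"
  shows "nn_parent n X i = nn_parent n Y i"
proof -
  have le: "nn_parent n X i \<le> nn_parent n Y i"
    if eq: "\<And>m. m \<noteq> k \<Longrightarrow> X m = Y m" and "nn_parent n X i \<noteq> k" "nn_parent n Y i \<noteq> k" for X Y
  proof (rule nn_parent_le)
    show lt: "nn_parent n Y i < i" using i nn_parent_less by blast
    fix j assume j: "j < i"
    have X: "X i = Y i" "X (nn_parent n X i) = Y (nn_parent n X i)" "X (nn_parent n Y i) = Y (nn_parent n Y i)"
      using that i by auto
    have "torus_dist n (X i) (X (nn_parent n Y i)) = torus_dist n (Y i) (Y (nn_parent n Y i))"
      using X by simp
    also have "\<dots> \<le> torus_dist n (Y i) (Y (nn_parent n X i))"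
      using nn_parent_dist_le i nn_parent_less by blast
    also have "\<dots> = torus_dist n (X i) (X (nn_parent n X i))" using X by simp
    also have "\<dots> \<le> torus_dist n (X i) (X j)" using nn_parent_dist_le i j by blast
    finally show "torus_dist n (X i) (X (nn_parent n Y i)) \<le> torus_dist n (X i) (X j)" .
  qed
  show ?thesis using le[of X Y] le[of Y X] eq par by (metis antisym)
qed

lemma nn_parent_cong_less:
  assumes "\<And>m. m \<le> i \<Longrightarrow> X m = Y m"
  shows "nn_parent n X i = nn_parent n Y i"
proof -
  have "(j < i \<and> (\<forall>k<i. torus_dist n (X i) (X j) \<le> torus_dist n (X i) (X k))) \<longleftrightarrow>
      (j < i \<and> (\<forall>k<i. torus_dist n (Y i) (Y j) \<le> torus_dist n (Y i) (Y k)))" for j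
    using assms[OF order_refl] assms[OF less_imp_le] by auto
  then show ?thesis unfolding nn_parent_def by simp
qed

text \<open>A vertex whose parent changes affects at most one edge in each tree, hence the factor 2.
  The summand 1 accounts for vertex \<open>k\<close> itself.\<close>

lemma card_sym_diff_nn_tree_le:
  assumes n: "0 < n" and eq: "\<And>m. m \<noteq> k \<Longrightarrow> X m = Y m"
  shows "real (card (sym_diff (nn_tree n X) (nn_tree n Y)))
    \<le> 2 * (1 + (\<Sum>j\<in>{Suc k..<n}. of_bool (cell_record n k (X k) X j) + of_bool (cell_record n k (Y k) Y j)))"
proof -
  define S where "S = {i \<in> {1..<n}. nn_parent n X i \<noteq> nn_parent n Y i}"
  define R where "R = {j \<in> {Suc k..<n}. cell_record n k (X k) X j}"
  define R' where "R' = {j \<in> {Suc k..<n}. cell_record n k (Y k) Y j}"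
  have fin: "finite S" "finite R" "finite R'" by (simp_all add: S_def R_def R'_def)
  have "sym_diff (nn_tree n X) (nn_tree n Y)
      \<subseteq> (\<lambda>i. {nn_parent n X i, i}) ` S \<union> (\<lambda>i. {nn_parent n Y i, i}) ` S"
  proof
    fix e assume "e \<in> sym_diff (nn_tree n X) (nn_tree n Y)"
    then obtain i where i: "i \<in> {1..<n}" "{nn_parent n X i, i} \<noteq> {nn_parent n Y i, i}"
      "e = {nn_parent n X i, i} \<or> e = {nn_parent n Y i, i}"
      unfolding nn_tree_def by blast
    then have "i \<in> S" unfolding S_def by auto
    with i(3) show "e \<in> (\<lambda>i. {nn_parent n X i, i}) ` S \<union> (\<lambda>i. {nn_parent n Y i, i}) ` S"
      by blast
  qed
  then have "card (sym_diff (nn_tree n X) (nn_tree n Y))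
      \<le> card ((\<lambda>i. {nn_parent n X i, i}) ` S \<union> (\<lambda>i. {nn_parent n Y i, i}) ` S)"
    using fin by (intro card_mono) auto
  also have "\<dots> \<le> card ((\<lambda>i. {nn_parent n X i, i}) ` S) + card ((\<lambda>i. {nn_parent n Y i, i}) ` S)"
    by (rule card_Un_le)
  also have "\<dots> \<le> card S + card S"
    using fin by (intro add_mono card_image_le)
  finally have 1: "card (sym_diff (nn_tree n X) (nn_tree n Y)) \<le> 2 * card S" by simp
  \<comment> \<open>Vertices before \<open>k\<close> do not see point \<open>k\<close>. A later
    vertex changes its parent only if the parent is \<open>k\<close> in one of the configurations,
    and then it is a record for that position of \<open>k\<close>.\<close>
  have "S \<subseteq> insert k (R \<union> R')"
  proof
    fix i assume i: "i \<in> S"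
    then have i': "0 < i" "i < n" "nn_parent n X i \<noteq> nn_parent n Y i" by (auto simp: S_def)
    show "i \<in> insert k (R \<union> R')"
    proof (cases "i \<le> k")
      case True
      then have "i = k" using nn_parent_cong_less[of i X Y n] eq i'(3) by fastforce
      then show ?thesis by simp
    next
      case False
      then have "nn_parent n X i = k \<or> nn_parent n Y i = k"
        using nn_parent_cong[of k X Y i n] eq i' by auto
      then have "cell_record n k (X k) X i \<or> cell_record n k (Y k) Y i"
        using cell_record_if_child[OF n, of k i X] cell_record_if_child[OF n, of k i Y] False by auto
      then show ?thesis using False i' by (auto simp: R_def R'_def)
    qed
  qed
  then have "card S \<le> card (insert k (R \<union> R'))" using fin by (intro card_mono) auto
  also have "\<dots> \<le> Suc (card (R \<union> R'))" by (rule card_insert_le_m1) auto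
  also have "\<dots> \<le> Suc (card R + card R')" using card_Un_le by simp
  finally have "card (sym_diff (nn_tree n X) (nn_tree n Y)) \<le> 2 * (1 + (card R + card R'))"
    using 1 by simp
  moreover have "real (card R) = (\<Sum>j\<in>{Suc k..<n}. of_bool (cell_record n k (X k) X j))"
    "real (card R') = (\<Sum>j\<in>{Suc k..<n}. of_bool (cell_record n k (Y k) Y j))"
    by (simp_all add: R_def R'_def of_bool_def sum.If_cases Int_def)
  ultimately show ?thesis by (simp add: sum.distrib flip: of_nat_le_iff[where 'a = real])
qed

section \<open>Conditional expectation of the number of children\<close>

text \<open>\<open>harm n - ln n\<close> is nonincreasing and equals 1 at
  \<open>n = 1\<close>.\<close>

lemma harm_le_1_plus_ln:
  assumes "0 < n"
  shows "(harm n :: real) \<le> 1 + ln (real n)"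
proof -
  obtain m where n: "n = Suc m" using assms gr0_implies_Suc by blast
  have "harm (Suc m) - ln (real (Suc m)) \<le> (harm (Suc 0) - ln (real (Suc 0)) :: real)"
    using decseqD[OF decseq_harm_diff_ln, of 0 m] by simp
  then show ?thesis by (simp add: n harm_def)
qed

lemma sum_inverse_shift_le:
  fixes k n :: nat
  assumes "0 < n"
  shows "(\<Sum>j\<in>{Suc k..<n}. 1 / real (j - k)) \<le> 1 + ln (real n)"
proof -
  have "(\<Sum>j\<in>{Suc k..<n}. 1 / real (j - k)) = (\<Sum>m\<in>(\<lambda>j. j - k) ` {Suc k..<n}. 1 / real m)"
    by (subst sum.reindex) (auto simp: inj_on_def)
  also have "\<dots> \<le> (\<Sum>m\<in>{1..n}. 1 / real m)"
    by (rule sum_mono2) auto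
  also have "\<dots> = harm n" by (simp add: harm_def inverse_eq_divide)
  finally show ?thesis using harm_le_1_plus_ln[OF assms] by simp
qed

section \<open>Uniform points on the torus: measurability and null sets\<close>

lemma prob_space_uniform_torus:
  assumes "0 < n"
  shows "prob_space (uniform_measure lborel (torus_domain n :: (real^'d::finite) set))"
proof (rule prob_space_uniform_measure)
  let ?s = "torus_side TYPE('d) n" and ?D = "torus_domain n :: (real^'d) set"
  have s: "0 < ?s" using assms by (simp add: torus_side_def)
  have meas: "?D \<in> sets lborel" unfolding torus_domain_def by simp
  have "(\<chi> i. ?s / 2) \<in> box 0 (\<chi> i. ?s :: real^'d)" using s by (simp add: mem_box_cart)
  then have "\<not> negligible (box 0 (\<chi> i. ?s :: real^'d))"
    by (intro open_not_negligible) auto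
  moreover have "box 0 (\<chi> i. ?s) \<subseteq> ?D"
    by (auto simp: torus_domain_def mem_box_cart intro: less_imp_le)
  ultimately have "\<not> negligible ?D" using negligible_subset by blast
  then show "emeasure lborel ?D \<noteq> 0"
    using meas by (auto simp: negligible_iff_null_sets null_sets_def)
  have "?D \<subseteq> cbox 0 (\<chi> i. ?s)"
    by (auto simp: torus_domain_def mem_box_cart) (metis less_imp_le)
  then have "emeasure lborel ?D \<le> emeasure lborel (cbox 0 (\<chi> i. ?s :: real^'d))"
    by (intro emeasure_mono) auto
  also have "\<dots> < \<infinity>" by (rule emeasure_lborel_cbox_finite)
  finally show "emeasure lborel ?D \<noteq> \<infinity>" by simp
qed

lemma borel_measurable_torus_diff [measurable]:
  "(\<lambda>x. torus_diff n x y) \<in> borel_measurable (borel :: (real^'d::finite) measure)"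
proof -
  have "(\<lambda>x :: real^'d. torus_diff n x y \<bullet> axis i 1) \<in> borel_measurable borel" for i
    unfolding torus_diff_def by (simp add: inner_axis) measurable
  then show ?thesis
    unfolding borel_measurable_euclidean_space[of "\<lambda>x. torus_diff n x y"] by (auto simp: Basis_vec_def)
qed

lemma pred_direction_cell [measurable]:
  "Measurable.pred borel (\<lambda>v :: real^'d::finite. direction_cell v = \<kappa>)"
proof -
  have "Measurable.pred borel (\<lambda>v :: real^'d. \<forall>i. of_int \<lfloor>real CARD('d) * (v $ i / norm v)\<rfloor> = (of_int (\<kappa> i) :: real))"
    by measurable
  then show ?thesis by (simp add: fun_eq_iff direction_cell_def)
qed

text \<open>Only the countably many lattice translates of \<open>y\<close> have difference
  zero.\<close>

lemma emeasure_torus_diff_eq_0: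
  "emeasure lborel {x :: real^'d::finite. torus_diff n x y = 0} = 0"
proof -
  have "{x :: real^'d. torus_diff n x y = 0} \<subseteq> (\<lambda>z. y + z) ` torus_lattice n"
  proof
    fix x :: "real^'d" assume "x \<in> {x. torus_diff n x y = 0}"
    moreover obtain z where "z \<in> torus_lattice n" "x - y = torus_diff n x y + z"
      by (rule torus_diff_lattice)
    ultimately show "x \<in> (\<lambda>z. y + z) ` torus_lattice n" by (auto simp: image_iff algebra_simps)
  qed
  then have "countable {x :: real^'d. torus_diff n x y = 0}"
    using countable_torus_lattice by (meson countable_image countable_subset)
  then show ?thesis using countable_imp_null_set_lborel by blast
qed

text \<open>Exchangeability bounds the event within one cell by \<open>1 / (j - k)\<close>, there
  being \<open>j - k\<close> points from \<open>k + 1\<close> to \<open>j\<close>; a union bound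
  over the cells gives the first factor. The position \<open>y\<close> is arbitrary but
  fixed.\<close>

lemma prob_cell_record:
  fixes y :: "real^'d::finite"
  assumes n: "0 < n" and j: "k < j" "j < n"
  defines "P \<equiv> Pi\<^sub>M {Suc k..<n} (\<lambda>_. uniform_measure lborel (torus_domain n :: (real^'d) set))"
  shows sets_cell_record: "{z \<in> space P. cell_record n k y z j} \<in> sets P"
    and prob_cell_record_le: "measure P {z \<in> space P. cell_record n k y z j}
      \<le> real (card (range (direction_cell :: real^'d \<Rightarrow> _))) * (1 / real (j - k))"
proof -
  let ?N = "uniform_measure lborel (torus_domain n :: (real^'d) set)"
  let ?R = "range (direction_cell :: real^'d \<Rightarrow> _)"
  let ?v = "\<lambda>x :: real^'d. torus_diff n x y"
  interpret P: prob_space P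
    unfolding P_def by (rule prob_space_PiM) (rule prob_space_uniform_torus[OF n])
  have comp: "(\<lambda>z. z m) \<in> measurable P borel" if "k < m" "m < n" for m
    unfolding P_def using that measurable_component_singleton[of m "{Suc k..<n}" "\<lambda>_. ?N"]
    by (simp cong: measurable_cong_sets)
  define Z where "Z = {z \<in> space P. ?v (z j) = 0}"
  \<comment> \<open>The cell of point \<open>j\<close> is random, whereas the exchangeability bound
    needs one predicate for all competitors. Hence the cell is fixed first.\<close>
  define E where "E \<kappa> = {z \<in> space P. direction_cell (?v (z j)) = \<kappa> \<and>
      (\<forall>m\<in>{Suc k..j} - {j}. direction_cell (?v (z m)) = \<kappa> \<longrightarrow> norm (?v (z j)) < norm (?v (z m)))}" for \<kappa>
  have eq: "{z \<in> space P. cell_record n k y z j} = Z \<union> (\<Union>\<kappa>\<in>?R. E \<kappa>)"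
  proof -
    have "{k<..<j} = {Suc k..j} - {j}" by auto
    then show ?thesis by (auto simp: cell_record_def Z_def E_def)
  qed
  have Z: "Z \<in> sets P"
  proof -
    have [measurable]: "(\<lambda>z. z j) \<in> measurable P borel" using comp j by simp
    show ?thesis unfolding Z_def by measurable
  qed
  have E: "E \<kappa> \<in> sets P" for \<kappa>
  proof -
    have [measurable]: "(\<lambda>z. z j) \<in> measurable P borel" using comp j by simp
    have [measurable]: "(\<lambda>z. z m) \<in> measurable P borel" if "m \<in> {Suc k..j} - {j}" for m
      using comp that j by simp
    have [measurable]: "finite ({Suc k..j} - {j})" by simp
    define q where "q x \<longleftrightarrow> direction_cell (?v x) = \<kappa>" for x
    have [measurable]: "Measurable.pred borel q"
      unfolding q_def by (rule measurable_compose[OF borel_measurable_torus_diff pred_direction_cell])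
    have "Measurable.pred P (\<lambda>z. q (z j) \<and>
      (\<forall>m\<in>{Suc k..j} - {j}. q (z m) \<longrightarrow> norm (?v (z j)) < norm (?v (z m))))"
      by measurable
    then show ?thesis by (simp add: E_def q_def pred_def)
  qed
  show "{z \<in> space P. cell_record n k y z j} \<in> sets P"
    unfolding eq using E finite_range_direction_cell by (intro sets.Un Z sets.finite_UN) auto
  have "P.prob Z = 0"
  proof -
    \<comment> \<open>The marginal of coordinate \<open>j\<close> is uniform, which reduces
      \<open>Z\<close> to a Lebesgue null set.\<close>
    have "distr P ?N (\<lambda>z. z j) = ?N"
      unfolding P_def by (rule distr_PiM_component) (use prob_space_uniform_torus[OF n] j in auto)
    moreover have "Z = (\<lambda>z. z j) -` {x. ?v x = 0} \<inter> space P" by (auto simp: Z_def)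
    moreover have "(\<lambda>z. z j) \<in> measurable P ?N"
      using comp j by (simp cong: measurable_cong_sets)
    moreover have V: "{x. ?v x = 0} \<in> sets borel"
    proof -
      have "{x \<in> space borel. ?v x = 0} \<in> sets borel" by measurable
      then show ?thesis by simp
    qed
    ultimately have "emeasure P Z = emeasure ?N {x. ?v x = 0}"
      using emeasure_distr[of "\<lambda>z. z j" P ?N "{x. ?v x = 0}"] by simp
    also have "\<dots> = emeasure lborel (torus_domain n \<inter> {x. ?v x = 0}) / emeasure lborel (torus_domain n :: (real^'d) set)"
      by (rule emeasure_uniform_measure) (use V in \<open>auto simp: torus_domain_def\<close>)
    also have "emeasure lborel (torus_domain n \<inter> {x. ?v x = 0}) = 0"
      using emeasure_mono[of "torus_domain n \<inter> {x. ?v x = 0}" "{x. ?v x = 0}" lborel] V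
      by (simp add: emeasure_torus_diff_eq_0)
    finally show ?thesis by (simp add: measure_def)
  qed
  moreover have "P.prob (E \<kappa>) \<le> 1 / real (j - k)" for \<kappa>
  proof -
    have "P.prob (E \<kappa>) \<le> 1 / real (card {Suc k..j})"
      unfolding E_def P_def
      by (rule prob_strict_minimum_le[OF prob_space_uniform_torus[OF n]])
        (use j in \<open>auto cong: measurable_cong_sets\<close>)
    then show ?thesis by simp
  qed
  then have "(\<Sum>\<kappa>\<in>?R. P.prob (E \<kappa>)) \<le> (\<Sum>\<kappa>\<in>?R. 1 / real (j - k))" by (rule sum_mono)
  moreover have "P.prob (\<Union>\<kappa>\<in>?R. E \<kappa>) \<le> (\<Sum>\<kappa>\<in>?R. P.prob (E \<kappa>))"
    using E finite_range_direction_cell by (intro measure_UNION_le) auto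
  moreover have "P.prob (Z \<union> (\<Union>\<kappa>\<in>?R. E \<kappa>)) \<le> P.prob Z + P.prob (\<Union>\<kappa>\<in>?R. E \<kappa>)"
    using E finite_range_direction_cell by (intro measure_Un_le Z sets.finite_UN) auto
  ultimately show "P.prob {z \<in> space P. cell_record n k y z j} \<le> real (card ?R) * (1 / real (j - k))"
    unfolding eq by simp
qed

section \<open>Increments of the Doob martingale\<close>

lemma cell_record_cong:
  assumes "k < j" "\<And>m. k < m \<Longrightarrow> m \<le> j \<Longrightarrow> X m = Y m"
  shows "cell_record n k y X j = cell_record n k y Y j"
  unfolding cell_record_def using assms by auto

text \<open>Both conditional means integrate over the same later points \<open>z\<close>, so their
  difference is the mean of a coupled difference of two trees that differ in the position of point
  \<open>k\<close> alone. The Lipschitz condition turns this into an expected number of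
  records.\<close>

lemma partial_mean_nn_tree_diff:
  fixes x :: "nat \<Rightarrow> real^'d::finite" and n :: nat
  defines "N \<equiv> uniform_measure lborel (torus_domain n :: (real^'d) set)"
    and "K \<equiv> real (card (range (direction_cell :: real^'d \<Rightarrow> _)))"
  assumes k: "k < n" and L: "0 \<le> L" and lip: "tree_lipschitz n L g"
    and x: "x \<in> space (Pi\<^sub>M {..<k} (\<lambda>_. N))"
  shows "\<bar>partial_mean (\<lambda>_. N) n (\<lambda>X. g (nn_tree n X)) (Suc k) (x(k := y))
      - partial_mean (\<lambda>_. N) n (\<lambda>X. g (nn_tree n X)) (Suc k) (x(k := y'))\<bar>
    \<le> L * (2 * (1 + 2 * (K * (1 + ln (real n)))))"
proof -
  have n: "0 < n" using k by simp
  interpret prob_sequence "\<lambda>_. N"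
    by (rule prob_sequence.intro) (simp add: N_def prob_space_uniform_torus[OF n])
  let ?Q = "Pi\<^sub>M {Suc k..<n} (\<lambda>_. N)"
  interpret Q: prob_space ?Q by (rule prob_space_PiM) (rule prob_M)
  define X where "X u z = merge {..<Suc k} {Suc k..<n} (x(k := u), z)" for u and z :: "nat \<Rightarrow> real^'d"
  define A where "A u j = {z \<in> space ?Q. cell_record n k u z j}" for u :: "real^'d" and j
  have A: "A u j \<in> sets ?Q" "Q.prob (A u j) \<le> K * (1 / real (j - k))" if "j \<in> {Suc k..<n}" for u j
    using that sets_cell_record[OF n, of k j u] prob_cell_record_le[OF n, of k j u]
    by (auto simp: A_def N_def K_def)
  have upd: "x(k := u) \<in> space (Pi\<^sub>M {..<Suc k} (\<lambda>_. N))" for u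
    using x by (auto simp: space_PiM lessThan_Suc PiE_iff extensional_def N_def)
  \<comment> \<open>There are finitely many labeled trees, so \<open>g\<close> is bounded on them
    and integrability is automatic.\<close>
  let ?B = "Max ((\<lambda>T. \<bar>g T\<bar>) ` labeled_trees n)"
  have int: "integrable ?Q (\<lambda>z. g (nn_tree n (X u z)))" for u
    unfolding X_def
  proof (rule integrable_merge_lessThan[where B = ?B])
    show "(\<lambda>X. g (nn_tree n X)) \<in> borel_measurable (Pi\<^sub>M {..<n} (\<lambda>_. N))"
      using measurable_compose[OF measurable_nn_tree[of n], of g borel]
      by (simp add: torus_points_def N_def)
    show "\<bar>g (nn_tree n X)\<bar> \<le> ?B" for X :: "nat \<Rightarrow> real^'d"
      using nn_tree_in_labeled_trees finite_labeled_trees by (intro Max_ge) auto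
  qed (use k in simp, rule upd)
  \<comment> \<open>The number of later records for the old position \<open>y\<close> plus that for
    the new position \<open>y'\<close>.\<close>
  define h where "h z = ((\<Sum>j\<in>{Suc k..<n}. indicator (A y j) z + indicator (A y' j) z) :: real)" for z
  have pw: "\<bar>g (nn_tree n (X y z)) - g (nn_tree n (X y' z))\<bar>
      \<le> L * (2 * (1 + h z))"
    if z: "z \<in> space ?Q" for z
  proof -
    have Xk: "X u z k = u" for u by (simp add: X_def merge_def)
    \<comment> \<open>All points after \<open>k\<close> come from \<open>z\<close>, so records do
      not depend on where point \<open>k\<close> sits in the merged configuration, only on the
      reference position \<open>u\<close>.\<close>
    have rec: "cell_record n k u (X u' z) j = cell_record n k u z j" if "j \<in> {Suc k..<n}" for u u' j
      using that by (intro cell_record_cong) (auto simp: X_def merge_def)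
    have "real (card (sym_diff (nn_tree n (X y z)) (nn_tree n (X y' z))))
      \<le> 2 * (1 + (\<Sum>j\<in>{Suc k..<n}. of_bool (cell_record n k (X y z k) (X y z) j)
          + of_bool (cell_record n k (X y' z k) (X y' z) j)))"
      by (rule card_sym_diff_nn_tree_le[OF n]) (simp add: X_def merge_def)
    also have "\<dots> = 2 * (1 + h z)"
      unfolding Xk h_def using z by (simp add: rec A_def indicator_def of_bool_def)
    finally have "L * real (card (sym_diff (nn_tree n (X y z)) (nn_tree n (X y' z))))
        \<le> L * (2 * (1 + h z))"
      by (rule mult_left_mono[OF _ L])
    moreover have "\<bar>g (nn_tree n (X y z)) - g (nn_tree n (X y' z))\<bar>
        \<le> L * real (card (sym_diff (nn_tree n (X y z)) (nn_tree n (X y' z))))"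
      using lip nn_tree_in_labeled_trees unfolding tree_lipschitz_def by blast
    ultimately show ?thesis by linarith
  qed
  have indint: "integrable ?Q (indicat_real (A u j))" if "j \<in> {Suc k..<n}" for u j
    using A(1)[OF that] by (intro integrable_real_indicator) (auto simp: Q.emeasure_eq_measure)
  have h_int: "integrable ?Q h"
    unfolding h_def by (intro Bochner_Integration.integrable_sum Bochner_Integration.integrable_add indint)
  have h_mean: "(\<integral>z. h z \<partial>?Q) = (\<Sum>j\<in>{Suc k..<n}. Q.prob (A y j) + Q.prob (A y' j))"
  proof -
    have "(\<integral>z. h z \<partial>?Q) = (\<Sum>j\<in>{Suc k..<n}. \<integral>z. indicator (A y j) z + indicator (A y' j) z \<partial>?Q)"
      unfolding h_def
      by (intro Bochner_Integration.integral_sum Bochner_Integration.integrable_add indint)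
    also have "\<dots> = (\<Sum>j\<in>{Suc k..<n}. Q.prob (A y j) + Q.prob (A y' j))"
    proof (rule sum.cong[OF refl])
      fix j assume j: "j \<in> {Suc k..<n}"
      show "(\<integral>z. indicator (A y j) z + indicator (A y' j) z \<partial>?Q) = Q.prob (A y j) + Q.prob (A y' j)"
        using indint[OF j] A(1)[OF j] by (subst Bochner_Integration.integral_add) auto
    qed
    finally show ?thesis .
  qed
  have "partial_mean (\<lambda>_. N) n (\<lambda>X. g (nn_tree n X)) (Suc k) (x(k := y))
      - partial_mean (\<lambda>_. N) n (\<lambda>X. g (nn_tree n X)) (Suc k) (x(k := y'))
      = (\<integral>z. g (nn_tree n (X y z)) - g (nn_tree n (X y' z)) \<partial>?Q)"
    unfolding partial_mean_def X_def[symmetric] using int by simp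
  also have "\<bar>\<integral>z. g (nn_tree n (X y z)) - g (nn_tree n (X y' z)) \<partial>?Q\<bar>
      \<le> (\<integral>z. \<bar>g (nn_tree n (X y z)) - g (nn_tree n (X y' z))\<bar> \<partial>?Q)"
    by (rule integral_abs_bound)
  also have "\<dots> \<le> (\<integral>z. L * (2 * (1 + h z)) \<partial>?Q)"
    using pw int h_int by (intro integral_mono) (auto simp: algebra_simps)
  also have "\<dots> = L * (2 * (1 + (\<Sum>j\<in>{Suc k..<n}. Q.prob (A y j) + Q.prob (A y' j))))"
    using h_int by (simp add: Q.prob_space h_mean)
  also have "\<dots> \<le> L * (2 * (1 + (\<Sum>j\<in>{Suc k..<n}. K * (1 / real (j - k)) + K * (1 / real (j - k)))))"
    using A(2) L by (intro mult_left_mono add_mono sum_mono) auto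
  also have "\<dots> = L * (2 * (1 + 2 * (K * (\<Sum>j\<in>{Suc k..<n}. 1 / real (j - k)))))"
    by (simp only: sum.distrib sum_distrib_left[symmetric]) (simp add: algebra_simps)
  also have "\<dots> \<le> L * (2 * (1 + 2 * (K * (1 + ln (real n)))))"
    using sum_inverse_shift_le[OF n, of k] L
    by (intro mult_left_mono add_mono) (auto simp: K_def)
  finally show ?thesis .
qed

theorem theorem1p4:
  shows "\<exists>C0>0. \<forall>\<^sub>F n in sequentially.
    \<forall>(L::real) (g :: nat set set \<Rightarrow> real) (\<phi>::real) (t::real).
      L > 0 \<longrightarrow> tree_lipschitz n L g \<longrightarrow> C0 * ln (real n) \<le> \<phi> \<longrightarrow> \<phi> \<le> real n / 3 \<longrightarrow> t \<ge> 0 \<longrightarrow>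
      (let P = (torus_points n :: (nat \<Rightarrow> real^'d::finite) measure);
           \<mu> = (\<integral>X. g (nn_tree n X) \<partial>P)
       in measure P {X \<in> space P. \<bar>g (nn_tree n X) - \<mu>\<bar> \<ge> t}
            \<le> 2 * exp (- (t\<^sup>2 / (20 * real n * L\<^sup>2 * \<phi>\<^sup>2))) + exp (- (\<phi> * ln \<phi> / 10)))"
proof -
  define K where "K = real (card (range (direction_cell :: real^'d \<Rightarrow> _)))"
  have K: "1 \<le> K"
    using finite_range_direction_cell[where 'd = 'd] by (simp add: K_def Suc_le_eq card_gt_0_iff)
  show ?thesis
  \<comment> \<open>For \<open>n\<close> at least 3 one has \<open>ln n\<close> at least 1, since
    \<open>exp 1\<close> is at most 3. Then the increment factor
    \<open>2 + 4 * K + 4 * K * ln n\<close> is at most \<open>10 * K * ln n\<close>, because 2 and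
    \<open>4 * K\<close> are at most \<open>2 * K * ln n\<close> and
    \<open>4 * K * ln n\<close>.\<close>
  proof (intro exI[of _ "10 * K"] conjI eventually_sequentiallyI[of 3] allI impI)
    show "0 < 10 * K" using K by simp
  next
    fix n :: nat and L \<phi> t :: real and g :: "nat set set \<Rightarrow> real"
    assume n: "3 \<le> n" and L: "L > 0" and lip: "tree_lipschitz n L g"
      and phi: "10 * K * ln (real n) \<le> \<phi>" and t: "0 \<le> t"
    define N where "N = uniform_measure lborel (torus_domain n :: (real^'d) set)"
    have n0: "0 < n" using n by simp
    interpret prob_sequence "\<lambda>_. N"
      by (rule prob_sequence.intro) (simp add: N_def prob_space_uniform_torus[OF n0])
    let ?P = "Pi\<^sub>M {..<n} (\<lambda>_. N)" and ?f = "\<lambda>X. g (nn_tree n X)"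
    have P: "torus_points n = ?P" by (simp add: torus_points_def N_def)
    have "exp 1 \<le> real n" using exp_le n by simp
    then have ln: "1 \<le> ln (real n)" using n0 by (simp add: ln_ge_iff)
    have Kln: "1 \<le> K * ln (real n)" "K \<le> K * ln (real n)"
      using K ln mult_mono[of 1 K 1 "ln (real n)"] by auto
    then have "2 * (1 + 2 * (K * (1 + ln (real n)))) \<le> \<phi>"
      using phi by (simp add: algebra_simps)
    then have c: "L * (2 * (1 + 2 * (K * (1 + ln (real n))))) \<le> L * \<phi>"
      using L by simp
    have \<phi>: "0 < \<phi>" using phi Kln by linarith
    have "measure ?P {X \<in> space ?P. t \<le> \<bar>?f X - (\<integral>X. ?f X \<partial>?P)\<bar>}
        \<le> 2 * exp (- (t\<^sup>2 / (2 * real n * (L * \<phi>)\<^sup>2)))"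
    proof (rule azuma_hoeffding[where B = "Max ((\<lambda>T. \<bar>g T\<bar>) ` labeled_trees n)"])
      show "?f \<in> borel_measurable ?P"
        using measurable_compose[OF measurable_nn_tree[where 'd = 'd and n = n], of g borel] by (simp add: P)
      show "\<bar>?f X\<bar> \<le> Max ((\<lambda>T. \<bar>g T\<bar>) ` labeled_trees n)" for X :: "nat \<Rightarrow> real^'d"
        using nn_tree_in_labeled_trees finite_labeled_trees by (intro Max_ge) auto
      show "\<bar>partial_mean (\<lambda>_. N) n ?f (Suc k) (x(k := y)) - partial_mean (\<lambda>_. N) n ?f (Suc k) (x(k := y'))\<bar> \<le> L * \<phi>"
        if "k < n" "x \<in> space (Pi\<^sub>M {..<k} (\<lambda>_. N))" for k x y y'
        using partial_mean_nn_tree_diff[OF that(1) less_imp_le[OF L] lip that(2)[unfolded N_def]] c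
        unfolding N_def K_def by (rule order_trans)
    qed (use t L \<phi> n0 in auto)
    \<comment> \<open>Azuma--Hoeffding with increments \<open>L * \<phi>\<close> has the constant 2
      in the denominator; enlarging it to 20 only weakens the bound.\<close>
    also have "\<dots> \<le> 2 * exp (- (t\<^sup>2 / (20 * real n * L\<^sup>2 * \<phi>\<^sup>2)))"
    proof -
      have "t\<^sup>2 / (20 * real n * L\<^sup>2 * \<phi>\<^sup>2) \<le> t\<^sup>2 / (2 * real n * (L * \<phi>)\<^sup>2)"
        using L \<phi> n0 by (intro divide_left_mono) (auto simp: power_mult_distrib)
      then show ?thesis by simp
    qed
    also have "\<dots> \<le> 2 * exp (- (t\<^sup>2 / (20 * real n * L\<^sup>2 * \<phi>\<^sup>2))) + exp (- (\<phi> * ln \<phi> / 10))"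
      by simp
    finally show "let P = (torus_points n :: (nat \<Rightarrow> real^'d) measure); \<mu> = (\<integral>X. g (nn_tree n X) \<partial>P)
       in measure P {X \<in> space P. \<bar>g (nn_tree n X) - \<mu>\<bar> \<ge> t}
            \<le> 2 * exp (- (t\<^sup>2 / (20 * real n * L\<^sup>2 * \<phi>\<^sup>2))) + exp (- (\<phi> * ln \<phi> / 10))"
      by (simp add: P Let_def)
  qed
qed

end
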